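(* Let $L(\mathbf{c})=\mathrm{span}\{X_1,\dots,X_n\}$ and $L'(\mathbf{d})=\mathrm{span}\{Y_1,\dots,Y_n\}$ be $n$-dimensional parametric real Lie algebras with structure constants $a_{ij}^k\in\mathbb{R}[\mathbf{c}]$ and $b_{ij}^k\in\mathbb{R}[\mathbf{d}]$, where the parameters $\mathbf{c}=(c_1,\dots,c_r)$ and $\mathbf{d}=(d_1,\dots,d_s)$ range over $$\mathbf{c}\in\mathscr{C}_0=Z_{\mathbb{R}}(F_0,N_0,P_0,H_0)\subset\mathbb{R}^r,\qquad \mathbf{d}\in\mathscr{C}_1=Z_{\mathbb{R}}(F_1,N_1,P_1,H_1)\subset\mathbb{R}^s,$$ with $F_0,N_0,P_0,H_0\subset\mathbb{R}[\mathbf{c}]$ and $F_1,N_1,P_1,H_1\subset\mathbb{R}[\mathbf{d}]$ finite sets of polynomials. Let $F$ be the set of polynomials in $\mathbb{R}[z,z_{11},\dots,z_{1n},\dots,z_{n1},\dots,z_{nn},\mathbf{c},\mathbf{d}]$ consisting of - $\sum_{k=1}^n z_{kt}\,a_{ij}^k-\sum_{k,l=1}^n z_{ik}z_{jl}\,b_{kl}^t$ for $1\le i<j\le n$ and $t=1,\dots,n$; - $1-z\det[\phi]$, where $[\phi]$ is the $n\times n$ matrix whose entry in row $j$ and column $i$ is $z_{ij}$; - all $f\in F_0\cup F_1$; and let $N=N_0\cup N_1$, $P=P_0\cup P_1$, $H=H_0\cup H_1$, and $\mathfrak{S}=[F,N,P,H]$, a semi-algebraic system in the variables $z,z_{11},\dots,z_{nn},\mathbf{c},\mathbf{d}$.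 Let $\pi_{\mathbb{R}}^{r+s}:\mathbb{R}^{n^2+1+r+s}\to\mathbb{R}^{r+s}$ be the projection $(z,(z_{ij}),\mathbf{c},\mathbf{d})\mapsto(\mathbf{c},\mathbf{d})$ to the parameter space. Then, for $\mathbf{c}\in\mathscr{C}_0$ and $\mathbf{d}\in\mathscr{C}_1$, the real Lie algebras $L(\mathbf{c})$ and $L'(\mathbf{d})$ are isomorphic if and only if $(\mathbf{c},\mathbf{d})\in\pi_{\mathbb{R}}^{r+s}(Z_{\mathbb{R}}(\mathfrak{S}))$.
   Context: For finite sets $F,N,P,H$ of real polynomials in $m$ variables, the semi-algebraic system $[F,N,P,H]$ is the conjunction of the conditions $f=0$ for all $f\in F$, $q\ge0$ for all $q\in N$, $p>0$ for all $p\in P$, and $h\neq0$ for all $h\in H$; its zero set $Z_{\mathbb{R}}(F,N,P,H)=Z_{\mathbb{R}}([F,N,P,H])\subset\mathbb{R}^m$ is the set of real points satisfying all these conditions. The parametric Lie algebras are given by $[X_i,X_j]=\sum_{k=1}^n a_{ij}^k(\mathbf{c})X_k$ and $[Y_i,Y_j]=\sum_{k=1}^n b_{ij}^k(\mathbf{d})Y_k$ for all $1\le i,j\le n$ (skew-symmetric in $i,j$); for each $\mathbf{c}\in\mathscr{C}_0$ (resp. $\mathbf{d}\in\mathscr{C}_1$) the values of the structure constants define a Lie algebra over $\mathbb{R}$, i.e. the Jacobi identity holds. An isomorphism of Lie algebras is an $\mathbb{R}$-linear isomorphism preserving brackets. The matrix $[\phi]$ corresponds to the linear map given by $\phi(X_i)=\sum_{k=1}^n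 z_{ik}Y_k$. *)

theory Defs
  imports
    "HOL-Library.Poly_Mapping"
    "HOL-Library.FuncSet"
    "Jordan_Normal_Form.Determinant"
begin

section \<open>Real polynomials in variables of type \<open>'v\<close>\<close>

text \<open>A monomial is a finitely supported exponent function, a polynomial a finitely supported
  coefficient function on monomials; the ring structure is that of \<open>Poly_Mapping\<close>.\<close>

type_synonym 'v rpoly = "('v \<Rightarrow>\<^sub>0 nat) \<Rightarrow>\<^sub>0 real"

definition pvar :: "'v \<Rightarrow> 'v rpoly" where
  "pvar v = Poly_Mapping.single (Poly_Mapping.single v 1) 1"

definition peval :: "('v \<Rightarrow> real) \<Rightarrow> 'v rpoly \<Rightarrow> real" where
  "peval x p = (\<Sum>m\<in>Poly_Mapping.keys p. Poly_Mapping.lookup p m *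
     (\<Prod>v\<in>Poly_Mapping.keys m. x v ^ Poly_Mapping.lookup m v))"

text \<open>The polynomial ring \<open>\<real>[V]\<close>. With one ambient type of variables, \<open>\<real>[V] \<subseteq> \<real>[W]\<close> whenever
  \<open>V \<subseteq> W\<close>, so no renaming of variables is needed.\<close>

definition polys :: "'v set \<Rightarrow> 'v rpoly set" where
  "polys V = {p. \<forall>m\<in>Poly_Mapping.keys p. Poly_Mapping.keys m \<subseteq> V}"


section \<open>Semi-algebraic systems\<close>

text \<open>A system \<open>[F, N, P, H]\<close>: \<open>f = 0\<close>, \<open>q \<ge> 0\<close>, \<open>p > 0\<close>, \<open>h \<noteq> 0\<close>.\<close>

type_synonym 'v sas = "'v rpoly set \<times> 'v rpoly set \<times> 'v rpoly set \<times> 'v rpoly set"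

definition sas_over :: "'v set \<Rightarrow> 'v sas \<Rightarrow> bool" where
  "sas_over V = (\<lambda>(F, N, P, H). finite F \<and> finite N \<and> finite P \<and> finite H \<and>
     F \<subseteq> polys V \<and> N \<subseteq> polys V \<and> P \<subseteq> polys V \<and> H \<subseteq> polys V)"

text \<open>Affine space with coordinates indexed by the finite set \<open>V\<close> of variables is the set
  \<open>V \<rightarrow>\<^sub>E UNIV\<close> of extensional functions, a copy of \<open>\<real>\<^sup>m\<close> with \<open>m = card V\<close>.\<close>

definition real_zeros :: "'v set \<Rightarrow> 'v sas \<Rightarrow> ('v \<Rightarrow> real) set" where
  "real_zeros V = (\<lambda>(F, N, P, H). {x \<in> V \<rightarrow>\<^sub>E UNIV.
     (\<forall>f\<in>F. peval x f = 0) \<and> (\<forall>q\<in>N. peval x q \<ge> 0) \<and>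
     (\<forall>p\<in>P. peval x p > 0) \<and> (\<forall>h\<in>H. peval x h \<noteq> 0)})"


section \<open>Real Lie algebras\<close>

text \<open>The underlying vector space is a subspace \<open>L\<close> of some real vector space, since its dimension
  is a natural number and not a type; outside \<open>L\<close> the bracket is arbitrary.\<close>

locale real_lie_algebra =
  fixes L :: "'a::real_vector set" and br :: "'a \<Rightarrow> 'a \<Rightarrow> 'a"
  assumes subspace: "subspace L"
    and closed: "\<lbrakk>x \<in> L; y \<in> L\<rbrakk> \<Longrightarrow> br x y \<in> L"
    and add_left: "\<lbrakk>x \<in> L; y \<in> L; z \<in> L\<rbrakk> \<Longrightarrow> br (x + y) z = br x z + br y z"
    and add_right: "\<lbrakk>x \<in> L; y \<in> L; z \<in> L\<rbrakk> \<Longrightarrow> br x (y + z) = br x y + br x z"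
    and scale_left: "\<lbrakk>x \<in> L; y \<in> L\<rbrakk> \<Longrightarrow> br (t *\<^sub>R x) y = t *\<^sub>R br x y"
    and scale_right: "\<lbrakk>x \<in> L; y \<in> L\<rbrakk> \<Longrightarrow> br x (t *\<^sub>R y) = t *\<^sub>R br x y"
    and alternating: "x \<in> L \<Longrightarrow> br x x = 0"
    and jacobi: "\<lbrakk>x \<in> L; y \<in> L; z \<in> L\<rbrakk> \<Longrightarrow>
      br x (br y z) + br y (br z x) + br z (br x y) = 0"

definition lie_isomorphic ::
  "'a::real_vector set \<Rightarrow> ('a \<Rightarrow> 'a \<Rightarrow> 'a) \<Rightarrow> 'b::real_vector set \<Rightarrow> ('b \<Rightarrow> 'b \<Rightarrow> 'b) \<Rightarrow> bool" where
  "lie_isomorphic L br L' br' \<longleftrightarrow> (\<exists>\<phi>. bij_betw \<phi> L L' \<and>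
     (\<forall>x\<in>L. \<forall>y\<in>L. \<phi> (x + y) = \<phi> x + \<phi> y) \<and>
     (\<forall>t. \<forall>x\<in>L. \<phi> (t *\<^sub>R x) = t *\<^sub>R \<phi> x) \<and>
     (\<forall>x\<in>L. \<forall>y\<in>L. \<phi> (br x y) = br' (\<phi> x) (\<phi> y)))"

text \<open>\<open>X 1, \<dots>, X n\<close> is a basis, the parameter point ranges over \<open>C\<close>, and \<open>a i j k\<close> is the structure
  constant \<open>a\<^sub>i\<^sub>j\<^sup>k\<close>, a polynomial in the parameters \<open>V\<close>. Skew-symmetry of its values on \<open>C\<close> is part of
  \<open>real_lie_algebra\<close>.\<close>

definition parametric_lie_algebra ::
  "nat \<Rightarrow> 'v set \<Rightarrow> ('v \<Rightarrow> real) set \<Rightarrow> (nat \<Rightarrow> nat \<Rightarrow> nat \<Rightarrow> 'v rpoly) \<Rightarrow>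
   (nat \<Rightarrow> 'a::real_vector) \<Rightarrow> (('v \<Rightarrow> real) \<Rightarrow> 'a \<Rightarrow> 'a \<Rightarrow> 'a) \<Rightarrow> bool" where
  "parametric_lie_algebra n V C a X br \<longleftrightarrow>
     inj_on X {1..n} \<and> independent (X ` {1..n}) \<and>
     (\<forall>i\<in>{1..n}. \<forall>j\<in>{1..n}. \<forall>k\<in>{1..n}. a i j k \<in> polys V) \<and>
     (\<forall>c\<in>C. real_lie_algebra (span (X ` {1..n})) (br c) \<and>
       (\<forall>i\<in>{1..n}. \<forall>j\<in>{1..n}. br c (X i) (X j) = (\<Sum>k=1..n. peval c (a i j k) *\<^sub>R X k)))"


section \<open>The isomorphism system\<close>

datatype var =
    VZ            \<comment> \<open>\<open>z\<close>\<close>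
  | VZij nat nat  \<comment> \<open>\<open>z\<^sub>i\<^sub>j\<close>\<close>
  | VC nat        \<comment> \<open>\<open>c\<^sub>i\<close>\<close>
  | VD nat        \<comment> \<open>\<open>d\<^sub>i\<close>\<close>

definition cvars :: "nat \<Rightarrow> var set" where
  "cvars r = VC ` {1..r}"

definition dvars :: "nat \<Rightarrow> var set" where
  "dvars s = VD ` {1..s}"

definition all_vars :: "nat \<Rightarrow> nat \<Rightarrow> nat \<Rightarrow> var set" where
  "all_vars n r s =
     {VZ} \<union> {VZij i j | i j. i \<in> {1..n} \<and> j \<in> {1..n}} \<union> cvars r \<union> dvars s"

text \<open>Row \<open>j\<close> and column \<open>i\<close> of \<open>[\<phi>]\<close> carry \<open>z\<^sub>i\<^sub>j\<close>; indices of \<open>mat\<close> start at 0.\<close>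

definition phi_mat :: "nat \<Rightarrow> var rpoly mat" where
  "phi_mat n = mat n n (\<lambda>(j, i). pvar (VZij (Suc i) (Suc j)))"

definition bracket_eqs ::
  "nat \<Rightarrow> (nat \<Rightarrow> nat \<Rightarrow> nat \<Rightarrow> var rpoly) \<Rightarrow> (nat \<Rightarrow> nat \<Rightarrow> nat \<Rightarrow> var rpoly) \<Rightarrow> var rpoly set" where
  "bracket_eqs n a b =
     {(\<Sum>k=1..n. pvar (VZij k t) * a i j k)
        - (\<Sum>k=1..n. \<Sum>l=1..n. pvar (VZij i k) * pvar (VZij j l) * b k l t)
      | i j t. 1 \<le> i \<and> i < j \<and> j \<le> n \<and> t \<in> {1..n}}"

definition iso_system ::
  "nat \<Rightarrow> (nat \<Rightarrow> nat \<Rightarrow> nat \<Rightarrow> var rpoly) \<Rightarrow> (nat \<Rightarrow> nat \<Rightarrow> nat \<Rightarrow> var rpoly) \<Rightarrow>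
   var sas \<Rightarrow> var sas \<Rightarrow> var sas" where
  "iso_system n a b = (\<lambda>(F0, N0, P0, H0) (F1, N1, P1, H1).
     (bracket_eqs n a b \<union> {1 - pvar VZ * det (phi_mat n)} \<union> F0 \<union> F1,
      N0 \<union> N1, P0 \<union> P1, H0 \<union> H1))"

text \<open>The projection to the parameter space, with \<open>\<real>\<^sup>r\<^sup>+\<^sup>s\<close> taken as \<open>\<real>\<^sup>r \<times> \<real>\<^sup>s\<close>.\<close>

definition param_proj ::
  "nat \<Rightarrow> nat \<Rightarrow> (var \<Rightarrow> real) \<Rightarrow> (var \<Rightarrow> real) \<times> (var \<Rightarrow> real)" where
  "param_proj r s x = (restrict x (cvars r), restrict x (dvars s))"

end

(* An isomorphism is determined by its matrix z in the two bases. A linear map preserves brackets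
   iff it does so on pairs of basis vectors, and by skew-symmetry pairs i < j suffice; comparing
   coordinates there gives the quadratic equations in z. It is bijective iff its matrix has nonzero
   determinant, which the slack variable z expresses as the equation z * det = 1. *)

theory Submission
  imports Defs
begin

section \<open>Evaluation at a point as a ring homomorphism\<close>

section \<open>Evaluation of polynomials\<close>

definition monom_eval :: "('v \<Rightarrow> real) \<Rightarrow> ('v \<Rightarrow>\<^sub>0 nat) \<Rightarrow> real" where
  "monom_eval x m = (\<Prod>v\<in>Poly_Mapping.keys m. x v ^ Poly_Mapping.lookup m v)"

text \<open>Variables outside the support have exponent 0 and contribute the factor 1. This allows
  several monomials to be evaluated over one common index set.\<close>

lemma monom_eval_superset:
  assumes "finite S" "Poly_Mapping.keys m \<subseteq> S"
  shows "monom_eval x m = (\<Prod>v\<in>S. x v ^ Poly_Mapping.lookup m v)"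
  unfolding monom_eval_def using assms
  by (intro prod.mono_neutral_left) (auto simp: in_keys_iff)

lemma monom_eval_add: "monom_eval x (m + m') = monom_eval x m * monom_eval x m'"
proof -
  define S where "S = Poly_Mapping.keys m \<union> Poly_Mapping.keys m'"
  have S: "finite S" "Poly_Mapping.keys m \<subseteq> S" "Poly_Mapping.keys m' \<subseteq> S"
    "Poly_Mapping.keys (m + m') \<subseteq> S"
    using Poly_Mapping.keys_add[of m m'] by (auto simp: S_def)
  show ?thesis
    by (simp add: monom_eval_superset[OF S(1,2)] monom_eval_superset[OF S(1,3)]
        monom_eval_superset[OF S(1,4)] lookup_add power_add prod.distrib)
qed

lemma peval_eq: "peval x p = (\<Sum>m\<in>Poly_Mapping.keys p. Poly_Mapping.lookup p m * monom_eval x m)"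
  by (simp add: peval_def monom_eval_def)

lemma peval_single: "peval x (Poly_Mapping.single m a) = a * monom_eval x m"
  by (cases "a = 0") (simp_all add: peval_eq)

lemma peval_add: "peval x (p + q) = peval x p + peval x q"
  unfolding peval_eq
  \<comment> \<open>Cancellation can make the support of \<open>p + q\<close> smaller than the union
    of the supports. The rule copes with this because the summand is additive in the coefficient and
    vanishes at coefficient 0.\<close>
  by (rule setsum_keys_plus_distrib[where f = "\<lambda>m a. a * monom_eval x m"])
    (simp_all add: distrib_right)

text \<open>Updating at a key outside the support is the same as adding a single term. In this
  additive shape, \<open>peval_add\<close> and distributivity reduce multiplicativity of evaluation
  to products of two terms.\<close>

lemma poly_mapping_single_add_induct [case_names zero single_add]:
  fixes f :: "'k \<Rightarrow>\<^sub>0 'c::monoid_add"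
  assumes "P 0" and step: "\<And>k a f. P f \<Longrightarrow> P (Poly_Mapping.single k a + f)"
  shows "P f"
proof (induction f rule: update_induct)
  case (update f k a)
  have "Poly_Mapping.update k a f = Poly_Mapping.single k a + f"
    using update(1)
    by (intro poly_mapping_eqI) (auto simp: lookup_update lookup_add lookup_single when_def in_keys_iff)
  then show ?case using step update(3) by simp
qed (fact assms(1))

lemma peval_zero: "peval x 0 = 0"
  by (simp add: peval_eq)

lemma peval_one: "peval x 1 = 1"
  by (simp add: peval_eq monom_eval_def)

lemma peval_single_mult:
  "peval x (Poly_Mapping.single m a * q) = a * monom_eval x m * peval x q"
proof (induction q rule: poly_mapping_single_add_induct)
  case (single_add k b q)
  then show ?case
    by (simp add: distrib_left peval_add mult_single peval_single monom_eval_add)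
qed (simp add: peval_zero)

lemma peval_mult: "peval x (p * q) = peval x p * peval x q"
proof (induction p rule: poly_mapping_single_add_induct)
  case (single_add m a p)
  then show ?case
    by (simp add: distrib_right peval_add peval_single_mult peval_single)
qed (simp add: peval_zero)

text \<open>Makes the general facts on ring homomorphisms available, above all that they commute
  with determinants.\<close>

interpretation peval: comm_ring_hom "peval x" for x
  by unfold_locales (simp_all add: peval_zero peval_one peval_add peval_mult)

lemma peval_pvar: "peval x (pvar v) = x v"
  by (simp add: pvar_def peval_single monom_eval_def)

text \<open>Used to compare a point of the full space with the parameter points \<open>c\<close> and
  \<open>d\<close>, which share only some of its coordinates.\<close>

lemma peval_cong_polys:
  assumes "p \<in> polys V" "\<And>v. v \<in> V \<Longrightarrow> x v = y v"
  shows "peval x p = peval y p"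
proof -
  have "monom_eval x m = monom_eval y m" if "m \<in> Poly_Mapping.keys p" for m
    unfolding monom_eval_def using that assms by (intro prod.cong) (auto simp: polys_def subset_iff)
  then show ?thesis unfolding peval_eq by (intro sum.cong) auto
qed


section \<open>Linear algebra over a finite independent family\<close>

section \<open>Coordinates with respect to a finite basis\<close>

lemma sum_scaleR_independent_unique:
  fixes X :: "'i \<Rightarrow> 'a::real_vector"
  assumes "finite I" "inj_on X I" "independent (X ` I)"
    and eq: "(\<Sum>i\<in>I. u i *\<^sub>R X i) = (\<Sum>i\<in>I. v i *\<^sub>R X i)" and "k \<in> I"
  shows "u k = v k"
proof (rule ccontr)
  assume ne: "u k \<noteq> v k"
  \<comment> \<open>Dependence is a notion for sets of vectors, so the coefficient differences are
    carried from indices to vectors along the inverse of the injective family.\<close>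
  let ?w = "\<lambda>x. u (the_inv_into I X x) - v (the_inv_into I X x)"
  have "(\<Sum>x\<in>X ` I. ?w x *\<^sub>R x) = (\<Sum>i\<in>I. (u i - v i) *\<^sub>R X i)"
    using assms(2) by (simp add: sum.reindex the_inv_into_f_f)
  also have "\<dots> = 0" using eq by (simp add: scaleR_diff_left sum_subtractf)
  finally have "(\<Sum>x\<in>X ` I. ?w x *\<^sub>R x) = 0" .
  moreover have "?w (X k) \<noteq> 0" using ne assms(2,5) by (simp add: the_inv_into_f_f)
  ultimately have "dependent (X ` I)"
    using assms(1,5) unfolding real_vector.dependent_finite[OF finite_imageI[OF assms(1)]]
    by (intro exI[of _ ?w]) auto
  then show False using assms(3) by simp
qed

lemma span_image_coordinates:
  fixes X :: "'i \<Rightarrow> 'a::real_vector"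
  assumes "finite I" "inj_on X I" "x \<in> span (X ` I)"
  obtains u where "x = (\<Sum>i\<in>I. u i *\<^sub>R X i)"
proof -
  obtain u where "x = (\<Sum>v\<in>X ` I. u v *\<^sub>R v)"
    using assms(3) real_vector.span_finite[OF finite_imageI[OF assms(1)], of X] by auto
  then have "x = (\<Sum>i\<in>I. u (X i) *\<^sub>R X i)" using assms(2) by (simp add: sum.reindex)
  then show thesis by (rule that)
qed

text \<open>Linearity is assumed on the subspace only. This fits both a Lie isomorphism and a
  bracket with one argument fixed, whose values outside \<open>L\<close> are arbitrary.\<close>

lemma additive_homogeneous_sum:
  fixes \<phi> :: "'a::real_vector \<Rightarrow> 'b::real_vector"
  assumes L: "subspace L" and x: "\<And>i. i \<in> I \<Longrightarrow> x i \<in> L"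
    and add: "\<And>x y. x \<in> L \<Longrightarrow> y \<in> L \<Longrightarrow> \<phi> (x + y) = \<phi> x + \<phi> y"
    and scale: "\<And>t x. x \<in> L \<Longrightarrow> \<phi> (t *\<^sub>R x) = t *\<^sub>R \<phi> x"
    and "finite I"
  shows "\<phi> (\<Sum>i\<in>I. u i *\<^sub>R x i) = (\<Sum>i\<in>I. u i *\<^sub>R \<phi> (x i))"
  using \<open>finite I\<close> x
proof (induction I rule: finite_induct)
  case empty
  \<comment> \<open>Homogeneity with scalar 0 gives the value 0 at the zero vector.\<close>
  show ?case using scale[OF real_vector.subspace_0[OF L], of 0] by simp
next
  case (insert i I)
  have "u i *\<^sub>R x i \<in> L" "(\<Sum>i\<in>I. u i *\<^sub>R x i) \<in> L"
    using insert.prems by (auto intro!: real_vector.subspace_sum real_vector.subspace_scale L)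
  then show ?case using insert add scale by simp
qed

lemma sum_scaleR_assoc:
  fixes Y :: "'j \<Rightarrow> 'b::real_vector"
  shows "(\<Sum>k\<in>I. u k *\<^sub>R (\<Sum>t\<in>J. w k t *\<^sub>R Y t)) = (\<Sum>t\<in>J. (\<Sum>k\<in>I. u k * w k t) *\<^sub>R Y t)"
  by (simp add: scaleR_sum_right scaleR_sum_left) (rule sum.swap)

lemma sum_scaleR_delta:
  fixes X :: "'i \<Rightarrow> 'a::real_vector"
  assumes "finite I" "i \<in> I"
  shows "(\<Sum>k\<in>I. (if i = k then 1 else 0) *\<^sub>R X k) = X i"
  using assms by (simp add: if_distrib[of "\<lambda>t. t *\<^sub>R _"] sum.delta cong: if_cong)

lemma linear_extension_family:
  fixes X :: "'i \<Rightarrow> 'a::real_vector" and f :: "'i \<Rightarrow> 'b::real_vector"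
  assumes "inj_on X I" "independent (X ` I)"
  obtains \<phi> where "linear \<phi>" "\<And>i. i \<in> I \<Longrightarrow> \<phi> (X i) = f i"
proof -
  obtain \<phi> where \<phi>: "linear \<phi>" "\<forall>x\<in>X ` I. \<phi> x = f (the_inv_into I X x)"
    using linear_independent_extend[OF assms(2), of "\<lambda>x. f (the_inv_into I X x)"] by blast
  then have "\<phi> (X i) = f i" if "i \<in> I" for i
    using that by (simp add: the_inv_into_f_f[OF assms(1)])
  with \<phi>(1) show thesis by (rule that)
qed


section \<open>Matrices of linear maps, their products and inverses\<close>

section \<open>The matrix of a linear map\<close>

text \<open>Column \<open>i\<close> holds the coordinates of the image of the basis vector with
  index \<open>Suc i\<close>, the same layout and index shift as in \<open>phi_mat\<close>.\<close>

definition transition_mat :: "nat \<Rightarrow> (nat \<Rightarrow> nat \<Rightarrow> 'a) \<Rightarrow> 'a mat" where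
  "transition_mat n z = mat n n (\<lambda>(j, i). z (Suc i) (Suc j))"

lemma transition_mat_carrier: "transition_mat n z \<in> carrier_mat n n"
  by (simp add: transition_mat_def)

text \<open>Composition of maps: \<open>z\<close> acts first, so its matrix is the right factor,
  while in the coordinate sum its entries come first.\<close>

lemma transition_mat_mult:
  fixes z w :: "nat \<Rightarrow> nat \<Rightarrow> 'a::comm_semiring_1"
  shows "transition_mat n w * transition_mat n z = transition_mat n (\<lambda>i k. \<Sum>l=1..n. z i l * w l k)"
proof (rule eq_matI)
  fix j i
  assume "j < dim_row (transition_mat n (\<lambda>i k. \<Sum>l=1..n. z i l * w l k))"
    and "i < dim_col (transition_mat n (\<lambda>i k. \<Sum>l=1..n. z i l * w l k))"
  then show "(transition_mat n w * transition_mat n z) $$ (j, i) =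
      transition_mat n (\<lambda>i k. \<Sum>l=1..n. z i l * w l k) $$ (j, i)"
    by (simp add: transition_mat_def scalar_prod_def sum.atLeast1_atMost_eq lessThan_atLeast0 mult.commute)
qed (simp_all add: transition_mat_def)

lemma transition_mat_one: "transition_mat n (\<lambda>i k. if i = k then 1 else 0) = 1\<^sub>m n"
  by (rule eq_matI) (auto simp: transition_mat_def)

lemma transition_mat_cong:
  assumes "\<And>i j. i \<in> {1..n} \<Longrightarrow> j \<in> {1..n} \<Longrightarrow> z i j = w i j"
  shows "transition_mat n z = transition_mat n w"
  using assms by (intro eq_matI) (auto simp: transition_mat_def)

lemma transition_mat_eq_iff:
  "transition_mat n z = transition_mat n w \<longleftrightarrow> (\<forall>i\<in>{1..n}. \<forall>j\<in>{1..n}. z i j = w i j)"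
proof
  assume eq: "transition_mat n z = transition_mat n w"
  show "\<forall>i\<in>{1..n}. \<forall>j\<in>{1..n}. z i j = w i j"
  proof (intro ballI)
    fix i j assume ij: "i \<in> {1..n}" "j \<in> {1..n}"
    then have "transition_mat n v $$ (j - 1, i - 1) = v i j" for v :: "nat \<Rightarrow> nat \<Rightarrow> 'a"
      by (cases i; cases j) (auto simp: transition_mat_def)
    then show "z i j = w i j" using eq by metis
  qed
qed (auto intro: transition_mat_cong)

text \<open>The two matrices multiply to the identity, so their determinants have product 1.\<close>

lemma transition_mat_det_nonzero:
  fixes z w :: "nat \<Rightarrow> nat \<Rightarrow> real"
  assumes "\<And>i k. i \<in> {1..n} \<Longrightarrow> k \<in> {1..n} \<Longrightarrow> (\<Sum>l=1..n. z i l * w l k) = (if i = k then 1 else 0)"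
  shows "det (transition_mat n w) \<noteq> 0"
proof -
  have "transition_mat n w * transition_mat n z = 1\<^sub>m n"
    unfolding transition_mat_mult transition_mat_one[symmetric]
    by (rule transition_mat_cong) (fact assms)
  then have "det (transition_mat n w) * det (transition_mat n z) = 1"
    using det_mult[OF transition_mat_carrier transition_mat_carrier, of n w z] by simp
  then show ?thesis by auto
qed

text \<open>The adjugate divided by the determinant is an inverse on both sides. The two identities
  later give the two compositions of a linear map with its inverse.\<close>

lemma transition_mat_inverse:
  fixes z :: "nat \<Rightarrow> nat \<Rightarrow> real"
  assumes det: "det (transition_mat n z) \<noteq> 0"
  obtains w where
    "\<And>i k. i \<in> {1..n} \<Longrightarrow> k \<in> {1..n} \<Longrightarrow> (\<Sum>l=1..n. z i l * w l k) = (if i = k then 1 else 0)"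
    "\<And>i k. i \<in> {1..n} \<Longrightarrow> k \<in> {1..n} \<Longrightarrow> (\<Sum>l=1..n. w i l * z l k) = (if i = k then 1 else 0)"
proof -
  let ?A = "transition_mat n z"
  define B where "B = inverse (det ?A) \<cdot>\<^sub>m adj_mat ?A"
  \<comment> \<open>Undoes the transposition and the shift between indices from 1 and from
    0.\<close>
  define w where "w i j = B $$ (j - 1, i - 1)" for i j
  have adj: "adj_mat ?A \<in> carrier_mat n n" "?A * adj_mat ?A = det ?A \<cdot>\<^sub>m 1\<^sub>m n"
    "adj_mat ?A * ?A = det ?A \<cdot>\<^sub>m 1\<^sub>m n"
    using adj_mat[OF transition_mat_carrier] by auto
  have B: "B \<in> carrier_mat n n" using adj(1) by (simp add: B_def)
  have scale: "inverse (det ?A) \<cdot>\<^sub>m (det ?A \<cdot>\<^sub>m 1\<^sub>m n) = 1\<^sub>m n"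
    using det by (intro eq_matI) auto
  have "?A * B = 1\<^sub>m n"
    using mult_smult_distrib[OF transition_mat_carrier adj(1)] adj(2) scale by (simp add: B_def)
  moreover have "B * ?A = 1\<^sub>m n"
    using mult_smult_assoc_mat[OF adj(1) transition_mat_carrier] adj(3) scale by (simp add: B_def)
  moreover have "B = transition_mat n w"
    using B by (intro eq_matI) (auto simp: transition_mat_def w_def)
  ultimately have
    "transition_mat n (\<lambda>i k. \<Sum>l=1..n. z i l * w l k) = transition_mat n (\<lambda>i k. if i = k then 1 else 0)"
    "transition_mat n (\<lambda>i k. \<Sum>l=1..n. w i l * z l k) = transition_mat n (\<lambda>i k. if i = k then 1 else 0)"
    by (simp_all add: transition_mat_mult transition_mat_one)
  then show thesis using that unfolding transition_mat_eq_iff by blast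
qed

section \<open>Lie isomorphisms correspond to invertible matrices satisfying the bracket
  relations\<close>

section \<open>Isomorphisms in coordinates\<close>

text \<open>Keeps the simplifier from turning the lower bound of \<open>{1..n}\<close> into
  \<open>Suc 0\<close>.\<close>

declare One_nat_def [simp del]

context real_lie_algebra
begin

text \<open>Linearity is applied in one argument at a time. The nested form of the result lets
  \<open>sum_scaleR_assoc\<close> collect coordinates.\<close>

lemma bracket_sum:
  assumes "finite I" "finite J" "\<And>i. i \<in> I \<Longrightarrow> x i \<in> L" "\<And>j. j \<in> J \<Longrightarrow> y j \<in> L"
  shows "br (\<Sum>i\<in>I. u i *\<^sub>R x i) (\<Sum>j\<in>J. v j *\<^sub>R y j) =
     (\<Sum>i\<in>I. u i *\<^sub>R (\<Sum>j\<in>J. v j *\<^sub>R br (x i) (y j)))"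
proof -
  have "br (\<Sum>i\<in>I. u i *\<^sub>R x i) b = (\<Sum>i\<in>I. u i *\<^sub>R br (x i) b)" if "b \<in> L" for b
    by (rule additive_homogeneous_sum[where \<phi> = "\<lambda>a. br a b", OF subspace])
      (auto simp: assms add_left scale_left that)
  moreover have "br a (\<Sum>j\<in>J. v j *\<^sub>R y j) = (\<Sum>j\<in>J. v j *\<^sub>R br a (y j))" if "a \<in> L" for a
    by (rule additive_homogeneous_sum[where \<phi> = "br a", OF subspace])
      (auto simp: assms add_right scale_right that)
  moreover have "(\<Sum>j\<in>J. v j *\<^sub>R y j) \<in> L"
    by (intro real_vector.subspace_sum real_vector.subspace_scale subspace assms)
  ultimately show ?thesis using assms by simp
qed

text \<open>Polarization: the bracket of \<open>x + y\<close> with itself vanishes, and expanding it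
  leaves the two mixed terms.\<close>

lemma anticommute:
  assumes "x \<in> L" "y \<in> L"
  shows "br y x = - br x y"
proof -
  have "0 = br (x + y) (x + y)"
    using assms by (simp add: alternating real_vector.subspace_add[OF subspace])
  also have "\<dots> = br x x + br x y + (br y x + br y y)"
    using assms by (simp add: add_left add_right real_vector.subspace_add[OF subspace])
  finally show ?thesis using assms by (simp add: alternating eq_neg_iff_add_eq_0 add.commute)
qed

end

text \<open>The situation at one fixed parameter point, where the structure constants have become
  real numbers.\<close>

locale lie_algebra_basis = real_lie_algebra "span (X ` {1..n})" br
  for n :: nat and X :: "nat \<Rightarrow> 'a::real_vector" and br +
  fixes \<alpha> :: "nat \<Rightarrow> nat \<Rightarrow> nat \<Rightarrow> real"
  assumes inj: "inj_on X {1..n}"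
    and independent: "independent (X ` {1..n})"
    and bracket_basis: "\<lbrakk>i \<in> {1..n}; j \<in> {1..n}\<rbrakk> \<Longrightarrow> br (X i) (X j) = (\<Sum>k=1..n. \<alpha> i j k *\<^sub>R X k)"
begin

abbreviation L :: "'a set" where "L \<equiv> span (X ` {1..n})"

lemma basis_in: "i \<in> {1..n} \<Longrightarrow> X i \<in> L"
  by (intro real_vector.span_base) auto

lemma sum_in: "(\<Sum>i=1..n. u i *\<^sub>R X i) \<in> L"
  by (intro real_vector.subspace_sum real_vector.subspace_scale subspace basis_in)

lemma coordinates_unique:
  assumes "(\<Sum>i=1..n. u i *\<^sub>R X i) = (\<Sum>i=1..n. v i *\<^sub>R X i)" "k \<in> {1..n}"
  shows "u k = v k"
  using sum_scaleR_independent_unique[OF _ inj independent assms] by simp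

lemma coordinates_exist:
  assumes "x \<in> L"
  obtains u where "x = (\<Sum>i=1..n. u i *\<^sub>R X i)"
  using span_image_coordinates[OF _ inj assms] by auto

end

locale lie_algebra_basis_pair =
  X: lie_algebra_basis n X br \<alpha> + Y: lie_algebra_basis n Y br' \<beta>
  for n :: nat and X :: "nat \<Rightarrow> 'a::real_vector" and br \<alpha>
    and Y :: "nat \<Rightarrow> 'b::real_vector" and br' \<beta>
begin

definition bracket_relations :: "(nat \<Rightarrow> nat \<Rightarrow> real) \<Rightarrow> bool" where
  "bracket_relations z \<longleftrightarrow> (\<forall>i j t. 1 \<le> i \<and> i < j \<and> j \<le> n \<and> t \<in> {1..n} \<longrightarrow>
     (\<Sum>k=1..n. z k t * \<alpha> i j k) = (\<Sum>k=1..n. \<Sum>l=1..n. z i k * z j l * \<beta> k l t))"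

text \<open>Both sides are expanded in the basis \<open>Y\<close>, and uniqueness of coordinates
  compares them for each \<open>t\<close>. Linearity enters only through \<open>sum\<close>, so the
  lemma covers maps linear on the span as well as on the whole space.\<close>

lemma map_bracket_basis_iff:
  assumes sum: "\<And>u. \<phi> (\<Sum>i=1..n. u i *\<^sub>R X i) = (\<Sum>i=1..n. u i *\<^sub>R \<phi> (X i))"
    and \<phi>: "\<forall>i\<in>{1..n}. \<phi> (X i) = (\<Sum>k=1..n. z i k *\<^sub>R Y k)"
    and ij: "i \<in> {1..n}" "j \<in> {1..n}"
  shows "\<phi> (br (X i) (X j)) = br' (\<phi> (X i)) (\<phi> (X j)) \<longleftrightarrow>
    (\<forall>t\<in>{1..n}. (\<Sum>k=1..n. z k t * \<alpha> i j k) = (\<Sum>k=1..n. \<Sum>l=1..n. z i k * z j l * \<beta> k l t))"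
proof -
  have "\<phi> (br (X i) (X j)) = (\<Sum>k=1..n. \<alpha> i j k *\<^sub>R (\<Sum>t=1..n. z k t *\<^sub>R Y t))"
    unfolding X.bracket_basis[OF ij] sum by (intro sum.cong) (simp_all add: \<phi>)
  then have lhs: "\<phi> (br (X i) (X j)) = (\<Sum>t=1..n. (\<Sum>k=1..n. z k t * \<alpha> i j k) *\<^sub>R Y t)"
    by (simp add: sum_scaleR_assoc mult.commute)
  have "br' (\<phi> (X i)) (\<phi> (X j)) = (\<Sum>k=1..n. z i k *\<^sub>R (\<Sum>l=1..n. z j l *\<^sub>R br' (Y k) (Y l)))"
    unfolding \<phi>[rule_format, OF ij(1)] \<phi>[rule_format, OF ij(2)]
    by (rule Y.bracket_sum) (auto simp: Y.basis_in)
  also have "\<dots> = (\<Sum>k=1..n. z i k *\<^sub>R (\<Sum>l=1..n. z j l *\<^sub>R (\<Sum>t=1..n. \<beta> k l t *\<^sub>R Y t)))"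
    by (intro sum.cong refl) (simp add: Y.bracket_basis)
  also have "\<dots> = (\<Sum>t=1..n. (\<Sum>k=1..n. z i k * (\<Sum>l=1..n. z j l * \<beta> k l t)) *\<^sub>R Y t)"
    by (simp only: sum_scaleR_assoc)
  finally have rhs: "br' (\<phi> (X i)) (\<phi> (X j)) =
      (\<Sum>t=1..n. (\<Sum>k=1..n. \<Sum>l=1..n. z i k * z j l * \<beta> k l t) *\<^sub>R Y t)"
    by (simp add: sum_distrib_left mult.assoc)
  show ?thesis
    unfolding lhs rhs
  proof (intro iffI ballI)
    fix t assume t: "t \<in> {1..n}"
      and "(\<Sum>t=1..n. (\<Sum>k=1..n. z k t * \<alpha> i j k) *\<^sub>R Y t) =
        (\<Sum>t=1..n. (\<Sum>k=1..n. \<Sum>l=1..n. z i k * z j l * \<beta> k l t) *\<^sub>R Y t)"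
    from this(2,1) show "(\<Sum>k=1..n. z k t * \<alpha> i j k) = (\<Sum>k=1..n. \<Sum>l=1..n. z i k * z j l * \<beta> k l t)"
      by (rule Y.coordinates_unique)
  qed (rule sum.cong, simp_all)
qed

lemma lie_isomorphic_imp_matrix:
  assumes "lie_isomorphic X.L br Y.L br'"
  shows "\<exists>z. det (transition_mat n z) \<noteq> 0 \<and> bracket_relations z"
proof -
  obtain \<phi> where bij: "bij_betw \<phi> X.L Y.L"
    and add: "\<And>x y. x \<in> X.L \<Longrightarrow> y \<in> X.L \<Longrightarrow> \<phi> (x + y) = \<phi> x + \<phi> y"
    and scale: "\<And>t x. x \<in> X.L \<Longrightarrow> \<phi> (t *\<^sub>R x) = t *\<^sub>R \<phi> x"
    and hom: "\<And>x y. x \<in> X.L \<Longrightarrow> y \<in> X.L \<Longrightarrow> \<phi> (br x y) = br' (\<phi> x) (\<phi> y)"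
    using assms unfolding lie_isomorphic_def by blast
  have sum: "\<phi> (\<Sum>i=1..n. u i *\<^sub>R X i) = (\<Sum>i=1..n. u i *\<^sub>R \<phi> (X i))" for u
    by (rule additive_homogeneous_sum[OF X.subspace]) (simp_all add: X.basis_in add scale)
  have "\<forall>i\<in>{1..n}. \<exists>u. \<phi> (X i) = (\<Sum>k=1..n. u k *\<^sub>R Y k)"
    using bij_betwE[OF bij] X.basis_in Y.coordinates_exist by metis
  then obtain z where z: "\<And>i. i \<in> {1..n} \<Longrightarrow> \<phi> (X i) = (\<Sum>k=1..n. z i k *\<^sub>R Y k)"
    by metis
  \<comment> \<open>By surjectivity each \<open>Y k\<close> has a preimage; the coordinates of these
    preimages form the candidate \<open>w\<close> for the inverse matrix.\<close>
  have "\<exists>u. Y k = \<phi> (\<Sum>i=1..n. u i *\<^sub>R X i)" if k: "k \<in> {1..n}" for k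
  proof -
    obtain x where x: "x \<in> X.L" "Y k = \<phi> x"
      using Y.basis_in[OF k] bij_betw_imp_surj_on[OF bij] by blast
    show ?thesis by (rule X.coordinates_exist[OF x(1)]) (use x(2) in blast)
  qed
  then obtain w where w: "\<And>k. k \<in> {1..n} \<Longrightarrow> Y k = \<phi> (\<Sum>i=1..n. w k i *\<^sub>R X i)"
    by metis
  \<comment> \<open>Mapping the preimage of \<open>Y i\<close> forward through \<open>z\<close>
    returns \<open>Y i\<close>; comparing coordinates gives the identity matrix.\<close>
  have "(\<Sum>l=1..n. w i l * z l k) = (if i = k then 1 else 0)" if ik: "i \<in> {1..n}" "k \<in> {1..n}" for i k
  proof (rule Y.coordinates_unique[OF _ ik(2)])
    have "(\<Sum>k=1..n. (\<Sum>l=1..n. w i l * z l k) *\<^sub>R Y k) =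
        (\<Sum>l=1..n. w i l *\<^sub>R (\<Sum>k=1..n. z l k *\<^sub>R Y k))"
      by (rule sum_scaleR_assoc[symmetric])
    also have "\<dots> = Y i"
      unfolding w[OF ik(1)] sum by (intro sum.cong) (simp_all add: z)
    also have "\<dots> = (\<Sum>k=1..n. (if i = k then 1 else 0) *\<^sub>R Y k)"
      by (rule sum_scaleR_delta[symmetric]) (use ik in simp_all)
    finally show "(\<Sum>k=1..n. (\<Sum>l=1..n. w i l * z l k) *\<^sub>R Y k) =
        (\<Sum>k=1..n. (if i = k then 1 else 0) *\<^sub>R Y k)" .
  qed
  then have "det (transition_mat n z) \<noteq> 0" by (rule transition_mat_det_nonzero)
  moreover have "bracket_relations z"
    unfolding bracket_relations_def
  proof (intro allI impI)
    fix i j t assume ijt: "1 \<le> i \<and> i < j \<and> j \<le> n \<and> t \<in> {1..n}"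
    then have ij: "i \<in> {1..n}" "j \<in> {1..n}" by auto
    have "\<phi> (br (X i) (X j)) = br' (\<phi> (X i)) (\<phi> (X j))"
      by (intro hom X.basis_in ij)
    then show "(\<Sum>k=1..n. z k t * \<alpha> i j k) = (\<Sum>k=1..n. \<Sum>l=1..n. z i k * z j l * \<beta> k l t)"
      using map_bracket_basis_iff[OF sum _ ij, of z] z ijt by simp
  qed
  ultimately show ?thesis by blast
qed

lemma matrix_imp_lie_isomorphic:
  assumes det: "det (transition_mat n z) \<noteq> 0" and rel: "bracket_relations z"
  shows "lie_isomorphic X.L br Y.L br'"
proof -
  obtain w where
    zw: "\<And>i k. i \<in> {1..n} \<Longrightarrow> k \<in> {1..n} \<Longrightarrow> (\<Sum>l=1..n. z i l * w l k) = (if i = k then 1 else 0)" and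
    wz: "\<And>i k. i \<in> {1..n} \<Longrightarrow> k \<in> {1..n} \<Longrightarrow> (\<Sum>l=1..n. w i l * z l k) = (if i = k then 1 else 0)"
    using transition_mat_inverse[OF det] by blast
  \<comment> \<open>The maps given by \<open>z\<close> and by its inverse \<open>w\<close> are
    extended linearly to the ambient spaces; they are shown to be mutually inverse on the two
    spans.\<close>
  obtain \<phi> where \<phi>: "linear \<phi>" "\<And>i. i \<in> {1..n} \<Longrightarrow> \<phi> (X i) = (\<Sum>k=1..n. z i k *\<^sub>R Y k)"
    using linear_extension_family[OF X.inj X.independent, of "\<lambda>i. \<Sum>k=1..n. z i k *\<^sub>R Y k"] by blast
  obtain \<psi> where \<psi>: "linear \<psi>" "\<And>i. i \<in> {1..n} \<Longrightarrow> \<psi> (Y i) = (\<Sum>k=1..n. w i k *\<^sub>R X k)"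
    using linear_extension_family[OF Y.inj Y.independent, of "\<lambda>i. \<Sum>k=1..n. w i k *\<^sub>R X k"] by blast
  have \<phi>_sum: "\<phi> (\<Sum>i=1..n. u i *\<^sub>R x i) = (\<Sum>i=1..n. u i *\<^sub>R \<phi> (x i))" for u x
    by (simp add: linear_sum[OF \<phi>(1)] linear_cmul[OF \<phi>(1)])
  have \<psi>_sum: "\<psi> (\<Sum>i=1..n. u i *\<^sub>R x i) = (\<Sum>i=1..n. u i *\<^sub>R \<psi> (x i))" for u x
    by (simp add: linear_sum[OF \<psi>(1)] linear_cmul[OF \<psi>(1)])
  have \<phi>_in: "\<phi> x \<in> Y.L" if "x \<in> X.L" for x
  proof -
    obtain u where "x = (\<Sum>i=1..n. u i *\<^sub>R X i)" using \<open>x \<in> X.L\<close> by (rule X.coordinates_exist)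
    then have "\<phi> x = (\<Sum>i=1..n. u i *\<^sub>R (\<Sum>k=1..n. z i k *\<^sub>R Y k))" by (simp add: \<phi>_sum \<phi>(2))
    then show ?thesis by (simp only: sum_scaleR_assoc Y.sum_in)
  qed
  have \<psi>_in: "\<psi> y \<in> X.L" if "y \<in> Y.L" for y
  proof -
    obtain u where "y = (\<Sum>i=1..n. u i *\<^sub>R Y i)" using \<open>y \<in> Y.L\<close> by (rule Y.coordinates_exist)
    then have "\<psi> y = (\<Sum>i=1..n. u i *\<^sub>R (\<Sum>k=1..n. w i k *\<^sub>R X k))" by (simp add: \<psi>_sum \<psi>(2))
    then show ?thesis by (simp only: sum_scaleR_assoc X.sum_in)
  qed
  have \<psi>\<phi>_basis: "\<psi> (\<phi> (X i)) = X i" if i: "i \<in> {1..n}" for i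
  proof -
    have "\<psi> (\<phi> (X i)) = (\<Sum>k=1..n. z i k *\<^sub>R (\<Sum>l=1..n. w k l *\<^sub>R X l))"
      unfolding \<phi>(2)[OF i] \<psi>_sum by (intro sum.cong) (simp_all add: \<psi>(2))
    also have "\<dots> = (\<Sum>l=1..n. (if i = l then 1 else 0) *\<^sub>R X l)"
      unfolding sum_scaleR_assoc by (intro sum.cong refl) (simp only: zw[OF i])
    finally show ?thesis using i by (simp only: sum_scaleR_delta finite_atLeastAtMost)
  qed
  have \<psi>\<phi>: "\<psi> (\<phi> x) = x" if "x \<in> X.L" for x
    using that by (rule X.coordinates_exist) (simp add: \<phi>_sum \<psi>_sum \<psi>\<phi>_basis)
  have \<phi>\<psi>_basis: "\<phi> (\<psi> (Y i)) = Y i" if i: "i \<in> {1..n}" for i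
  proof -
    have "\<phi> (\<psi> (Y i)) = (\<Sum>k=1..n. w i k *\<^sub>R (\<Sum>l=1..n. z k l *\<^sub>R Y l))"
      unfolding \<psi>(2)[OF i] \<phi>_sum by (intro sum.cong) (simp_all add: \<phi>(2))
    also have "\<dots> = (\<Sum>l=1..n. (if i = l then 1 else 0) *\<^sub>R Y l)"
      unfolding sum_scaleR_assoc by (intro sum.cong refl) (simp only: wz[OF i])
    finally show ?thesis using i by (simp only: sum_scaleR_delta finite_atLeastAtMost)
  qed
  have \<phi>\<psi>: "\<phi> (\<psi> y) = y" if "y \<in> Y.L" for y
    using that by (rule Y.coordinates_exist) (simp add: \<phi>_sum \<psi>_sum \<phi>\<psi>_basis)
  have bij: "bij_betw \<phi> X.L Y.L"
    by (rule bij_betw_byWitness[of _ \<psi>]) (auto simp: \<phi>_in \<psi>_in \<psi>\<phi> \<phi>\<psi>)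
  have less: "\<phi> (br (X i) (X j)) = br' (\<phi> (X i)) (\<phi> (X j))"
    if ij: "i \<in> {1..n}" "j \<in> {1..n}" and "i < j" for i j
    using map_bracket_basis_iff[of \<phi> z, OF \<phi>_sum _ ij] \<phi>(2) rel ij \<open>i < j\<close>
    by (simp add: bracket_relations_def)
  \<comment> \<open>The relations cover \<open>i < j\<close>. On the diagonal both brackets vanish,
    and for \<open>j < i\<close> both sides change sign under exchange.\<close>
  have basis: "\<phi> (br (X i) (X j)) = br' (\<phi> (X i)) (\<phi> (X j))"
    if ij: "i \<in> {1..n}" "j \<in> {1..n}" for i j
  proof (rule linorder_cases[of i j])
    assume "i < j"
    with ij show ?thesis by (rule less)
  next
    assume "i = j"
    then show ?thesis
      using ij by (simp add: X.alternating Y.alternating X.basis_in \<phi>_in linear_0[OF \<phi>(1)])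
  next
    assume "j < i"
    have "\<phi> (br (X i) (X j)) = - \<phi> (br (X j) (X i))"
      using X.anticommute[OF X.basis_in X.basis_in, OF ij(2,1)] by (simp add: linear_neg[OF \<phi>(1)])
    also have "\<dots> = - br' (\<phi> (X j)) (\<phi> (X i))"
      using less[OF ij(2,1) \<open>j < i\<close>] by simp
    also have "\<dots> = br' (\<phi> (X i)) (\<phi> (X j))"
      using Y.anticommute[of "\<phi> (X j)" "\<phi> (X i)"] ij X.basis_in \<phi>_in by simp
    finally show ?thesis .
  qed
  have "\<phi> (br x y) = br' (\<phi> x) (\<phi> y)" if "x \<in> X.L" "y \<in> X.L" for x y
  proof -
    obtain u where x: "x = (\<Sum>i=1..n. u i *\<^sub>R X i)" using \<open>x \<in> X.L\<close> by (rule X.coordinates_exist)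
    obtain v where y: "y = (\<Sum>i=1..n. v i *\<^sub>R X i)" using \<open>y \<in> X.L\<close> by (rule X.coordinates_exist)
    have "\<phi> (br x y) = \<phi> (\<Sum>i=1..n. u i *\<^sub>R (\<Sum>j=1..n. v j *\<^sub>R br (X i) (X j)))"
      unfolding x y by (subst X.bracket_sum) (auto simp: X.basis_in)
    also have "\<dots> = (\<Sum>i=1..n. u i *\<^sub>R (\<Sum>j=1..n. v j *\<^sub>R br' (\<phi> (X i)) (\<phi> (X j))))"
      unfolding \<phi>_sum by (intro sum.cong refl) (simp add: basis)
    also have "\<dots> = br' (\<phi> x) (\<phi> y)"
      unfolding x y \<phi>_sum by (subst Y.bracket_sum) (auto simp: X.basis_in \<phi>_in)
    finally show ?thesis .
  qed
  then show ?thesis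
    unfolding lie_isomorphic_def using bij linear_add[OF \<phi>(1)] linear_cmul[OF \<phi>(1)] by blast
qed

end


section \<open>From matrices to zeros of the semi-algebraic system\<close>

section \<open>The isomorphism system\<close>

lemma parametric_lie_algebra_basis:
  assumes "parametric_lie_algebra n V C a X br" "c \<in> C"
  shows "lie_algebra_basis n X (br c) (\<lambda>i j k. peval c (a i j k))"
  using assms by (auto simp: parametric_lie_algebra_def lie_algebra_basis_def lie_algebra_basis_axioms_def)

text \<open>A ring homomorphism commutes with the determinant, so it suffices to evaluate the
  entries.\<close>

lemma peval_det_phi_mat: "peval x (det (phi_mat n)) = det (transition_mat n (\<lambda>i j. x (VZij i j)))"
proof -
  have "map_mat (peval x) (phi_mat n) = transition_mat n (\<lambda>i j. x (VZij i j))"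
    by (rule eq_matI) (auto simp: phi_mat_def transition_mat_def peval_pvar)
  then show ?thesis using peval.hom_det[of x "phi_mat n"] by simp
qed

lemma peval_bracket_eqs_zero_iff:
  "(\<forall>f\<in>bracket_eqs n a b. peval x f = 0) \<longleftrightarrow>
    (\<forall>i j t. 1 \<le> i \<and> i < j \<and> j \<le> n \<and> t \<in> {1..n} \<longrightarrow>
      (\<Sum>k=1..n. x (VZij k t) * peval x (a i j k)) =
      (\<Sum>k=1..n. \<Sum>l=1..n. x (VZij i k) * x (VZij j l) * peval x (b k l t)))"
proof -
  have eq: "peval x ((\<Sum>k=1..n. pvar (VZij k t) * a i j k)
      - (\<Sum>k=1..n. \<Sum>l=1..n. pvar (VZij i k) * pvar (VZij j l) * b k l t)) =
    (\<Sum>k=1..n. x (VZij k t) * peval x (a i j k)) -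
      (\<Sum>k=1..n. \<Sum>l=1..n. x (VZij i k) * x (VZij j l) * peval x (b k l t))" for i j t
    by (simp add: peval.hom_minus peval.hom_sum peval_mult peval_pvar)
  have ball_iff: "(\<forall>f\<in>{g i j t | i j t. Q i j t}. R f) \<longleftrightarrow> (\<forall>i j t. Q i j t \<longrightarrow> R (g i j t))"
    for g :: "nat \<Rightarrow> nat \<Rightarrow> nat \<Rightarrow> var rpoly" and Q R by blast
  show ?thesis unfolding bracket_eqs_def ball_iff eq by simp
qed

text \<open>Lifts a parameter point to the full affine space: the conditions read only coordinates
  in \<open>V\<close>, and extensionality on \<open>W\<close> is supplied separately.\<close>

lemma real_zeros_cong:
  assumes S: "sas_over V S" and xy: "\<And>v. v \<in> V \<Longrightarrow> x v = y v" and "y \<in> real_zeros V S"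
    and x: "x \<in> W \<rightarrow>\<^sub>E UNIV"
  shows "x \<in> real_zeros W S"
proof -
  obtain F N P H where [simp]: "S = (F, N, P, H)" by (cases S)
  have eq: "peval x p = peval y p" if "p \<in> F \<union> N \<union> P \<union> H" for p
    using that S xy by (intro peval_cong_polys[of p V]) (auto simp: sas_over_def)
  show ?thesis using \<open>y \<in> _\<close> x eq by (simp add: real_zeros_def)
qed

theorem theorem6p2:
  fixes n r s :: nat
    and F0 N0 P0 H0 F1 N1 P1 H1 :: "var rpoly set"
    and C0 C1 :: "(var \<Rightarrow> real) set"
    and a b :: "nat \<Rightarrow> nat \<Rightarrow> nat \<Rightarrow> var rpoly"
    and X :: "nat \<Rightarrow> 'a::real_vector" and Y :: "nat \<Rightarrow> 'b::real_vector"
    and brL :: "(var \<Rightarrow> real) \<Rightarrow> 'a \<Rightarrow> 'a \<Rightarrow> 'a"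
    and brL' :: "(var \<Rightarrow> real) \<Rightarrow> 'b \<Rightarrow> 'b \<Rightarrow> 'b"
    and c d :: "var \<Rightarrow> real"
  assumes "sas_over (cvars r) (F0, N0, P0, H0)"
    and "sas_over (dvars s) (F1, N1, P1, H1)"
    and "C0 = real_zeros (cvars r) (F0, N0, P0, H0)"
    and "C1 = real_zeros (dvars s) (F1, N1, P1, H1)"
    and "parametric_lie_algebra n (cvars r) C0 a X brL"
    and "parametric_lie_algebra n (dvars s) C1 b Y brL'"
    and "c \<in> C0" and "d \<in> C1"
  shows "lie_isomorphic (span (X ` {1..n})) (brL c) (span (Y ` {1..n})) (brL' d) \<longleftrightarrow>
    (c, d) \<in> param_proj r s `
      real_zeros (all_vars n r s) (iso_system n a b (F0, N0, P0, H0) (F1, N1, P1, H1))"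
proof -
  let ?S0 = "(F0, N0, P0, H0)" and ?S1 = "(F1, N1, P1, H1)"
  let ?V = "all_vars n r s"
  let ?Z = "real_zeros ?V (iso_system n a b ?S0 ?S1)"
  interpret lie_algebra_basis_pair n X "brL c" "\<lambda>i j k. peval c (a i j k)"
      Y "brL' d" "\<lambda>i j k. peval d (b i j k)"
    using parametric_lie_algebra_basis[OF assms(5,7)] parametric_lie_algebra_basis[OF assms(6,8)]
    by (rule lie_algebra_basis_pair.intro)
  have polys: "a i j k \<in> polys (cvars r)" "b i j k \<in> polys (dvars s)"
    if "i \<in> {1..n}" "j \<in> {1..n}" "k \<in> {1..n}" for i j k
    using assms(5,6) that by (auto simp: parametric_lie_algebra_def)
  \<comment> \<open>The combined system splits into the two parameter systems, read in the full
    space, the bracket equations and the determinant equation.\<close>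
  have in_Z: "x \<in> ?Z \<longleftrightarrow> x \<in> real_zeros ?V ?S0 \<and> x \<in> real_zeros ?V ?S1 \<and>
      (\<forall>f\<in>bracket_eqs n a b. peval x f = 0) \<and>
      x VZ * det (transition_mat n (\<lambda>i j. x (VZij i j))) = 1" for x
    by (auto simp: real_zeros_def iso_system_def peval.hom_minus peval_one peval_mult peval_pvar
        peval_det_phi_mat)
  \<comment> \<open>Over \<open>(c, d)\<close> the structure constants take the same values at
    \<open>x\<close> as at \<open>c\<close> and \<open>d\<close>.\<close>
  have relations: "(\<forall>f\<in>bracket_eqs n a b. peval x f = 0) \<longleftrightarrow> bracket_relations (\<lambda>i j. x (VZij i j))"
    if xc: "\<And>v. v \<in> cvars r \<Longrightarrow> x v = c v" and xd: "\<And>v. v \<in> dvars s \<Longrightarrow> x v = d v" for x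
  proof -
    have "peval x (a i j k) = peval c (a i j k)" "peval x (b i j k) = peval d (b i j k)"
      if "i \<in> {1..n}" "j \<in> {1..n}" "k \<in> {1..n}" for i j k
      using peval_cong_polys[OF polys(1)[OF that] xc] peval_cong_polys[OF polys(2)[OF that] xd]
      by simp_all
    then have "(\<Sum>k=1..n. x (VZij k t) * peval x (a i j k)) =
          (\<Sum>k=1..n. x (VZij k t) * peval c (a i j k))"
      and "(\<Sum>k=1..n. \<Sum>l=1..n. x (VZij i k) * x (VZij j l) * peval x (b k l t)) =
          (\<Sum>k=1..n. \<Sum>l=1..n. x (VZij i k) * x (VZij j l) * peval d (b k l t))"
      if "1 \<le> i \<and> i < j \<and> j \<le> n \<and> t \<in> {1..n}" for i j t
      using that by (auto intro!: sum.cong)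
    then show ?thesis
      unfolding peval_bracket_eqs_zero_iff bracket_relations_def by (simp cong: imp_cong)
  qed
  show ?thesis
  proof
    assume "lie_isomorphic (span (X ` {1..n})) (brL c) (span (Y ` {1..n})) (brL' d)"
    then obtain z where det: "det (transition_mat n z) \<noteq> 0" and rel: "bracket_relations z"
      using lie_isomorphic_imp_matrix by blast
    \<comment> \<open>The slack coordinate is the reciprocal of the determinant. Restriction makes
      the point extensional and keeps every matrix entry with indices in
      \<open>{1..n}\<close>.\<close>
    define x where "x = restrict (\<lambda>v. case v of VZ \<Rightarrow> inverse (det (transition_mat n z))
      | VZij i j \<Rightarrow> z i j | VC i \<Rightarrow> c (VC i) | VD i \<Rightarrow> d (VD i)) ?V"
    have x: "x \<in> ?V \<rightarrow>\<^sub>E UNIV" by (simp add: x_def)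
    have xc: "x v = c v" if "v \<in> cvars r" for v
      using that by (auto simp: x_def all_vars_def cvars_def)
    have xd: "x v = d v" if "v \<in> dvars s" for v
      using that by (auto simp: x_def all_vars_def dvars_def)
    have xz: "x (VZij i j) = z i j" if "i \<in> {1..n}" "j \<in> {1..n}" for i j
      using that by (auto simp: x_def all_vars_def)
    have "transition_mat n (\<lambda>i j. x (VZij i j)) = transition_mat n z"
      by (rule transition_mat_cong) (rule xz)
    then have "x VZ * det (transition_mat n (\<lambda>i j. x (VZij i j))) = 1"
      using det by (simp add: x_def all_vars_def)
    moreover have "bracket_relations (\<lambda>i j. x (VZij i j))"
      using rel unfolding bracket_relations_def by (auto simp: xz)
    moreover have "x \<in> real_zeros ?V ?S0"
      using real_zeros_cong[OF assms(1) xc _ x] assms(3,7) by blast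
    moreover have "x \<in> real_zeros ?V ?S1"
      using real_zeros_cong[OF assms(2) xd _ x] assms(4,8) by blast
    ultimately have "x \<in> ?Z" by (simp add: in_Z relations xc xd)
    moreover have "c \<in> cvars r \<rightarrow>\<^sub>E UNIV" "d \<in> dvars s \<rightarrow>\<^sub>E UNIV"
      using assms(3,4,7,8) by (auto simp: real_zeros_def)
    \<comment> \<open>Equality of functions, since \<open>c\<close> and \<open>d\<close> are
      themselves \<open>undefined\<close> outside their variables.\<close>
    then have "restrict x (cvars r) = c" "restrict x (dvars s) = d"
      using xc xd by (auto intro!: ext simp: restrict_def PiE_def extensional_def)
    ultimately show "(c, d) \<in> param_proj r s ` ?Z"
      by (intro image_eqI[of _ _ x]) (simp_all add: param_proj_def)
  next
    assume "(c, d) \<in> param_proj r s ` ?Z"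
    then obtain x where x: "x \<in> ?Z" and "c = restrict x (cvars r)" "d = restrict x (dvars s)"
      by (auto simp: param_proj_def)
    then have "bracket_relations (\<lambda>i j. x (VZij i j))" using relations[of x] by (simp add: in_Z)
    \<comment> \<open>A product equal to 1 has no zero factor.\<close>
    moreover have "det (transition_mat n (\<lambda>i j. x (VZij i j))) \<noteq> 0" using x by (auto simp: in_Z)
    ultimately show "lie_isomorphic (span (X ` {1..n})) (brL c) (span (Y ` {1..n})) (brL' d)"
      by (intro matrix_imp_lie_isomorphic)
  qed
qed

end
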